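(* Let $k\ge 1$ be an integer and let $\widehat G=\wr^{\infty}(\mathbb Z/k\mathbb Z,A_k)$ be the infinite iterated permutational wreath product of cyclic groups of order $k$. Let $g\in\widehat G$ be a finite state transformation, given by a finite state initial automaton. Then it is decidable whether $g$ is spherically transitive. That is, there is an algorithm which, given as input a finite state initial automaton over $A_k$ computing an element $g\in\widehat G$, decides whether $g$ is spherically transitive.
   Context: Let $A_k=\{0,\dots,k-1\}$ and let $T_k$ be the rooted regular $k$-ary tree, viewed as the Cayley graph of the free monoid $A_k^*$, so that vertices are words over $A_k$, the root is the empty word $\varepsilon$, and each word $u$ is joined to $ua$ for $a\in A_k$. $\mathrm{Aut}(T_k)$ is the group of automorphisms of this rooted tree; it acts on $A_k^*$ preserving length. Sections: for $f\in\mathrm{Aut}(T_k)$ and $u\in A_k^*$, the section $f_u\in\mathrm{Aut}(T_k)$ is the unique automorphism with $f(uw)=f(u)f_u(w)$ for all $w\in A_k^*$. Let $\lambda_f\in S_k=\mathrm{Sym}(A_k)$ be the permutation $a\mapsto f(a)$ of $A_k$ induced by $f$. The element $f$ is finite state if $\{f_w\mid w\in A_k^*\}$ is finite. Iterated wreath product: for a transitive permutation group $(G,A_k)$, i.e. $G\le S_k$ transitive on $A_k$, $\widehat G=\wr^\infty(G,A_k)=(G,A_k)\wr(G,A_k)\wr\cdots$ is the closed subgroup of $\mathrm{Aut}(T_k)$ consisting of all $f$ such that $\lambda_{f_w}\in G$ for every $w\in A_k^*$. Here $(\mathbb Z/k\mathbb Z,A_k)$ is the cyclic group of order $k$ acting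 regularly on $A_k$ by addition modulo $k$. Automata: a finite state automaton over an alphabet $A$ is $\mathcal A=(Q,A,\delta,\lambda)$ with $Q$ a finite set of states, transition function $\delta:Q\times A\to Q$ and output function $\lambda:Q\times A\to A$. Write $q_a=\delta(q,a)$, $q(a)=\lambda(q,a)$. Each state $q$ defines a length-preserving map $q:A^*\to A^*$ by $q(\varepsilon)=\varepsilon$ and $q(au)=q(a)\,q_a(u)$ for $a\in A$, $u\in A^*$. An initial automaton is an automaton with a distinguished (initial) state; it computes the map $A^*\to A^*$ defined by that state. An element of $\mathrm{Aut}(T_k)$ is finite state if and only if it is computed by some finite state initial automaton over $A_k$. An element $f\in\mathrm{Aut}(T_k)$ is spherically transitive if, for each $n\ge 0$, $\langle f\rangle$ acts transitively on the set $A_k^n$ of words of length $n$. *)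

theory Defs
  imports "HOL-Algebra.Algebra" "HOL-Library.Nat_Bijection"
begin

section \<open>Automorphisms of the regular rooted tree\<close>

text \<open>
  The alphabet is \<open>{..<k}\<close>, and the vertices of the tree are the words \<open>lists {..<k}\<close>.
  As in \<^theory>\<open>HOL-Algebra.Bij\<close>, maps on a set are represented by total functions that are
  \<open>undefined\<close> outside the set, so that elements of groups of bijections are equal as soon as they
  agree on the set.
\<close>

abbreviation words :: "nat \<Rightarrow> nat list set" where
  "words k \<equiv> lists {..<k}"

definition word_level :: "nat \<Rightarrow> nat \<Rightarrow> nat list set" where
  "word_level k n = {w \<in> words k. length w = n}"

definition tree_edges :: "nat \<Rightarrow> nat list set set" where
  "tree_edges k = {{u, u @ [a]} | u a. u \<in> words k \<and> a < k}"

definition tree_aut :: "nat \<Rightarrow> (nat list \<Rightarrow> nat list) set" where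
  "tree_aut k = {f \<in> Bij (words k). f [] = [] \<and>
     (\<forall>u\<in>words k. \<forall>v\<in>words k. {f u, f v} \<in> tree_edges k \<longleftrightarrow> {u, v} \<in> tree_edges k)}"

definition AutT :: "nat \<Rightarrow> (nat list \<Rightarrow> nat list) monoid" where
  "AutT k = (BijGroup (words k))\<lparr>carrier := tree_aut k\<rparr>"

definition tree_section :: "nat \<Rightarrow> (nat list \<Rightarrow> nat list) \<Rightarrow> nat list \<Rightarrow> nat list \<Rightarrow> nat list" where
  "tree_section k f u = (\<lambda>w\<in>words k. drop (length u) (f (u @ w)))"

text \<open>
  The section at \<open>u\<close> is characterised by \<open>tree_section_append\<close> and \<open>tree_section_unique\<close> below.
\<close>

definition root_perm :: "nat \<Rightarrow> (nat list \<Rightarrow> nat list) \<Rightarrow> nat \<Rightarrow> nat" where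
  "root_perm k f = (\<lambda>a\<in>{..<k}. hd (f [a]))"

definition iterated_wreath :: "nat \<Rightarrow> (nat \<Rightarrow> nat) set \<Rightarrow> (nat list \<Rightarrow> nat list) set" where
  "iterated_wreath k G =
     {f \<in> tree_aut k. \<forall>w\<in>words k. root_perm k (tree_section k f w) \<in> G}"

definition cyclic_perms :: "nat \<Rightarrow> (nat \<Rightarrow> nat) set" where
  "cyclic_perms k = {(\<lambda>a\<in>{..<k}. (a + c) mod k) | c. c < k}"

definition spherically_transitive :: "nat \<Rightarrow> (nat list \<Rightarrow> nat list) \<Rightarrow> bool" where
  "spherically_transitive k f \<longleftrightarrow>
     (\<forall>n. \<forall>u\<in>word_level k n. \<forall>v\<in>word_level k n. \<exists>h\<in>generate (AutT k) {f}. h u = v)"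

lemma tree_edge_cases:
  assumes "{u, v} \<in> tree_edges k"
  obtains a where "a < k" "v = u @ [a]" | a where "a < k" "u = v @ [a]"
  using assms unfolding tree_edges_def by (auto simp: doubleton_eq_iff)

lemma tree_edge_snoc: "u \<in> words k \<Longrightarrow> a < k \<Longrightarrow> {u, u @ [a]} \<in> tree_edges k"
  unfolding tree_edges_def by blast

lemma tree_aut_in_words: "f \<in> tree_aut k \<Longrightarrow> w \<in> words k \<Longrightarrow> f w \<in> words k"
  unfolding tree_aut_def Bij_def by (auto dest: bij_betwE)

lemma tree_aut_inj: "f \<in> tree_aut k \<Longrightarrow> inj_on f (words k)"
  unfolding tree_aut_def Bij_def by (auto simp: bij_betw_def)

lemma tree_aut_Nil: "f \<in> tree_aut k \<Longrightarrow> f [] = []"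
  unfolding tree_aut_def by simp

lemma tree_aut_edge:
  "f \<in> tree_aut k \<Longrightarrow> u \<in> words k \<Longrightarrow> v \<in> words k \<Longrightarrow>
     {f u, f v} \<in> tree_edges k \<longleftrightarrow> {u, v} \<in> tree_edges k"
  unfolding tree_aut_def by blast

lemma tree_aut_snoc:
  assumes f: "f \<in> tree_aut k"
  shows "u \<in> words k \<Longrightarrow> a < k \<Longrightarrow> \<exists>b<k. f (u @ [a]) = f u @ [b]"
proof (induction u arbitrary: a rule: rev_induct)
  case Nil
  have "{f [], f ([] @ [a])} \<in> tree_edges k"
    using tree_aut_edge[OF f, of "[]" "[a]"] Nil tree_edge_snoc[of "[]" k a] by simp
  moreover have "f [] = []" by (rule tree_aut_Nil[OF f])
  ultimately show ?case by (auto elim: tree_edge_cases)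
next
  case (snoc x u)
  have u: "u \<in> words k" and x: "x < k" using snoc.prems by auto
  obtain c where c: "f (u @ [x]) = f u @ [c]" using snoc.IH[OF u x] by blast
  have "{f (u @ [x]), f ((u @ [x]) @ [a])} \<in> tree_edges k"
    using tree_aut_edge[OF f, of "u @ [x]" "(u @ [x]) @ [a]"] snoc.prems
      tree_edge_snoc[of "u @ [x]" k a] by simp
  then show ?case
  proof (cases rule: tree_edge_cases)
    case 2
    then have "f (u @ [x, a]) = f u" using c by auto
    then have "u @ [x, a] = u"
      using inj_onD[OF tree_aut_inj[OF f], of "u @ [x, a]" u] u snoc.prems by auto
    then show ?thesis by simp
  qed blast
qed

lemma tree_aut_append:
  assumes f: "f \<in> tree_aut k" and u: "u \<in> words k"
  shows "w \<in> words k \<Longrightarrow> \<exists>v\<in>words k. length v = length w \<and> f (u @ w) = f u @ v"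
proof (induction w rule: rev_induct)
  case (snoc x w)
  then obtain v where v: "v \<in> words k" "length v = length w" "f (u @ w) = f u @ v" by auto
  moreover obtain b where "b < k" "f ((u @ w) @ [x]) = f (u @ w) @ [b]"
    using tree_aut_snoc[OF f, of "u @ w" x] u snoc.prems by auto
  ultimately show ?case by (intro bexI[of _ "v @ [b]"]) auto
qed auto

lemma tree_aut_length: "f \<in> tree_aut k \<Longrightarrow> w \<in> words k \<Longrightarrow> length (f w) = length w"
  using tree_aut_append[of f k "[]" w] unfolding tree_aut_def by auto

lemma tree_section_append:
  assumes "f \<in> tree_aut k" "u \<in> words k" "w \<in> words k"
  shows "f (u @ w) = f u @ tree_section k f u w"
  using tree_aut_append[OF assms] tree_aut_length[OF assms(1,2)] assms(3)
  by (auto simp: tree_section_def)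

lemma tree_section_unique:
  assumes "f \<in> tree_aut k" "u \<in> words k" "h \<in> tree_aut k"
    and "\<And>w. w \<in> words k \<Longrightarrow> f (u @ w) = f u @ h w"
  shows "h = tree_section k f u"
proof (rule extensionalityI[of _ "words k"])
  show "h \<in> extensional (words k)" using assms(3) unfolding tree_aut_def Bij_def by auto
  show "tree_section k f u \<in> extensional (words k)" unfolding tree_section_def by simp
  show "h w = tree_section k f u w" if "w \<in> words k" for w
    using assms(4)[OF that] tree_section_append[OF assms(1,2) that] by simp
qed

lemma tree_section_in_tree_aut:
  assumes f: "f \<in> tree_aut k" and u: "u \<in> words k"
  shows "tree_section k f u \<in> tree_aut k"
proof -
  let ?h = "tree_section k f u"
  note app = tree_section_append[OF f u]
  have cl: "?h w \<in> words k" if "w \<in> words k" for w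
    using tree_aut_append[OF f u that] app[OF that] by auto
  have inj: "inj_on ?h (words k)"
  proof (rule inj_onI)
    fix v w assume "v \<in> words k" "w \<in> words k" "?h v = ?h w"
    then have "f (u @ v) = f (u @ w)" using app by simp
    then have "u @ v = u @ w"
      using inj_onD[OF tree_aut_inj[OF f], of "u @ v" "u @ w"] u \<open>v \<in> words k\<close> \<open>w \<in> words k\<close>
      by simp
    then show "v = w" by simp
  qed
  have surj: "\<exists>w\<in>words k. ?h w = v" if v: "v \<in> words k" for v
  proof -
    have "f ` words k = words k" using f unfolding tree_aut_def Bij_def bij_betw_def by auto
    moreover have "f u @ v \<in> words k" using tree_aut_in_words[OF f u] v by simp
    ultimately obtain z where z: "z \<in> words k" "f z = f u @ v" by (metis imageE)
    define z1 z2 where "z1 = take (length u) z" and "z2 = drop (length u) z"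
    have zz: "z = z1 @ z2" unfolding z1_def z2_def by simp
    have zw: "z1 \<in> words k" "z2 \<in> words k" using z(1) zz by auto
    have "length z = length (f u @ v)" using tree_aut_length[OF f z(1)] z(2) by simp
    then have l1: "length z1 = length u" using tree_aut_length[OF f u] unfolding z1_def by simp
    have "f z1 @ tree_section k f z1 z2 = f u @ v"
      using tree_section_append[OF f zw] z(2) zz by simp
    then have "f z1 = f u"
      using tree_aut_length[OF f zw(1)] tree_aut_length[OF f u] l1 by simp
    then have "z1 = u" using inj_onD[OF tree_aut_inj[OF f]] zw u by blast
    then show ?thesis using app[OF zw(2)] z(2) zz zw(2) by auto
  qed
  have pre: "{x @ v, x @ w} \<in> tree_edges k \<longleftrightarrow> {v, w} \<in> tree_edges k"
    if "x \<in> words k" "v \<in> words k" "w \<in> words k" for x v w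
  proof
    assume "{x @ v, x @ w} \<in> tree_edges k"
    then show "{v, w} \<in> tree_edges k"
    proof (cases rule: tree_edge_cases)
      case (1 a)
      then show ?thesis using tree_edge_snoc[OF that(2)] by simp
    next
      case (2 a)
      then show ?thesis using tree_edge_snoc[OF that(3)] by (simp add: insert_commute)
    qed
  next
    assume "{v, w} \<in> tree_edges k"
    then show "{x @ v, x @ w} \<in> tree_edges k"
    proof (cases rule: tree_edge_cases)
      case (1 a)
      then show ?thesis using tree_edge_snoc[of "x @ v"] that by simp
    next
      case (2 a)
      then show ?thesis using tree_edge_snoc[of "x @ w"] that by (simp add: insert_commute)
    qed
  qed
  have edges: "{?h v, ?h w} \<in> tree_edges k \<longleftrightarrow> {v, w} \<in> tree_edges k"
    if v: "v \<in> words k" and w: "w \<in> words k" for v w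
  proof -
    have "{?h v, ?h w} \<in> tree_edges k \<longleftrightarrow> {f (u @ v), f (u @ w)} \<in> tree_edges k"
      using pre[OF tree_aut_in_words[OF f u] cl[OF v] cl[OF w]] app[OF v] app[OF w] by simp
    also have "\<dots> \<longleftrightarrow> {u @ v, u @ w} \<in> tree_edges k"
      using tree_aut_edge[OF f, of "u @ v" "u @ w"] u v w by simp
    finally show ?thesis using pre[OF u v w] by simp
  qed
  have "?h [] = []" using app[of "[]"] by simp
  moreover have "?h ` words k = words k"
  proof
    show "?h ` words k \<subseteq> words k" using cl by blast
    show "words k \<subseteq> ?h ` words k" using surj by (metis imageI subsetI)
  qed
  then have "?h \<in> Bij (words k)"
    unfolding Bij_def bij_betw_def using inj by (simp add: tree_section_def)
  ultimately show ?thesis using edges unfolding tree_aut_def by blast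
qed

lemma subgroup_tree_aut: "subgroup (tree_aut k) (BijGroup (words k))"
proof -
  interpret B: group "BijGroup (words k)" by (rule group_BijGroup)
  show ?thesis
  proof (rule B.subgroupI)
    show "tree_aut k \<subseteq> carrier (BijGroup (words k))"
      unfolding tree_aut_def BijGroup_def by auto
    have "(\<lambda>w\<in>words k. w) \<in> tree_aut k" unfolding tree_aut_def using id_Bij by auto
    then show "tree_aut k \<noteq> {}" by blast
  next
    fix f assume f: "f \<in> tree_aut k"
    then have fB: "f \<in> Bij (words k)" unfolding tree_aut_def by simp
    define g where "g = restrict (inv_into (words k) f) (words k)"
    have inv: "inv\<^bsub>BijGroup (words k)\<^esub> f = g" unfolding g_def by (rule inv_BijGroup[OF fB])
    have gB: "g \<in> Bij (words k)" unfolding g_def by (rule restrict_inv_into_Bij[OF fB])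
    have "f ` words k = words k" using fB unfolding Bij_def bij_betw_def by simp
    then have fg: "f (g w) = w" "g w \<in> words k" if "w \<in> words k" for w
      using f_inv_into_f[of w f "words k"] inv_into_into[of w f "words k"] that
      by (simp_all only: g_def restrict_apply if_True)
    have "g [] = []"
      using inj_onD[OF tree_aut_inj[OF f], of "g []" "[]"] fg[of "[]"] tree_aut_Nil[OF f] by simp
    moreover have "{g u, g v} \<in> tree_edges k \<longleftrightarrow> {u, v} \<in> tree_edges k"
      if "u \<in> words k" "v \<in> words k" for u v
      using tree_aut_edge[OF f, of "g u" "g v"] fg[OF that(1)] fg[OF that(2)] by simp
    ultimately show "inv\<^bsub>BijGroup (words k)\<^esub> f \<in> tree_aut k"
      using gB unfolding inv tree_aut_def by blast
  next
    fix f g assume f: "f \<in> tree_aut k" and g: "g \<in> tree_aut k"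
    have fB: "f \<in> Bij (words k)" and gB: "g \<in> Bij (words k)"
      using f g unfolding tree_aut_def by simp_all
    have "compose (words k) f g \<in> tree_aut k"
      unfolding tree_aut_def
    proof (intro CollectI conjI ballI)
      show "compose (words k) f g \<in> Bij (words k)" by (rule compose_Bij[OF fB gB])
      show "compose (words k) f g [] = []"
        using tree_aut_Nil[OF f] tree_aut_Nil[OF g] by (simp add: compose_def)
      fix u v assume uv: "u \<in> words k" "v \<in> words k"
      show "{compose (words k) f g u, compose (words k) f g v} \<in> tree_edges k \<longleftrightarrow>
          {u, v} \<in> tree_edges k"
        using tree_aut_edge[OF g uv]
          tree_aut_edge[OF f tree_aut_in_words[OF g uv(1)] tree_aut_in_words[OF g uv(2)]]
        by (simp only: compose_eq[OF uv(1)] compose_eq[OF uv(2)])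
    qed
    then show "f \<otimes>\<^bsub>BijGroup (words k)\<^esub> g \<in> tree_aut k"
      using fB gB by (simp add: BijGroup_def)
  qed
qed

lemma group_AutT: "group (AutT k)"
  unfolding AutT_def by (rule subgroup.subgroup_is_group[OF subgroup_tree_aut group_BijGroup])


section \<open>Automata\<close>

record 'q automaton =
  states :: "'q set"
  transition :: "'q \<Rightarrow> nat \<Rightarrow> 'q"
  letter_out :: "'q \<Rightarrow> nat \<Rightarrow> nat"

definition initial_automaton :: "nat \<Rightarrow> 'q automaton \<Rightarrow> 'q \<Rightarrow> bool" where
  "initial_automaton k A q \<longleftrightarrow> finite (states A) \<and> q \<in> states A \<and>
     (\<forall>p\<in>states A. \<forall>a<k. transition A p a \<in> states A \<and> letter_out A p a < k)"

primrec run :: "'q automaton \<Rightarrow> 'q \<Rightarrow> nat list \<Rightarrow> nat list" where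
  "run A q [] = []"
| "run A q (a # u) = letter_out A q a # run A (transition A q a) u"

definition computed_map :: "nat \<Rightarrow> 'q automaton \<Rightarrow> 'q \<Rightarrow> nat list \<Rightarrow> nat list" where
  "computed_map k A q = (\<lambda>w\<in>words k. run A q w)"

text \<open>
  To be given to an algorithm, an initial automaton must have its states numbered
  \<open>0, \<dots>, m - 1\<close>. Its code lists the initial state and, for every state, the row of pairs of
  successor and output for the letters \<open>0, \<dots>, k - 1\<close>.
\<close>

definition automaton_code :: "nat \<Rightarrow> nat automaton \<times> nat \<Rightarrow> nat" where
  "automaton_code k = (\<lambda>(A, q). prod_encode (q, list_encode
     (map (\<lambda>p. list_encode (map (\<lambda>a. prod_encode (transition A p a, letter_out A p a)) [0..<k]))
       [0..<card (states A)])))"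

definition automata_computing :: "nat \<Rightarrow> (nat list \<Rightarrow> nat list) set \<Rightarrow> (nat automaton \<times> nat) set" where
  "automata_computing k F = {(A, q). initial_automaton k A q \<and>
     states A = {..<card (states A)} \<and> computed_map k A q \<in> F}"

lemma automaton_code_inj:
  assumes "automaton_code k (A, q) = automaton_code k (B, r)"
    and "states A = {..<card (states A)}" "states B = {..<card (states B)}"
  shows "q = r" "states A = states B"
    "\<And>p a. p \<in> states A \<Longrightarrow> a < k \<Longrightarrow> transition A p a = transition B p a \<and> letter_out A p a = letter_out B p a"
proof -
  have q: "q = r" and rows:
    "map (\<lambda>p. list_encode (map (\<lambda>a. prod_encode (transition A p a, letter_out A p a)) [0..<k]))
       [0..<card (states A)] =
     map (\<lambda>p. list_encode (map (\<lambda>a. prod_encode (transition B p a, letter_out B p a)) [0..<k]))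
       [0..<card (states B)]"
    using assms(1) by (simp_all add: automaton_code_def list_encode_eq)
  have card: "card (states A) = card (states B)" using arg_cong[OF rows, of length] by simp
  show "q = r" by (rule q)
  show "states A = states B" using assms(2,3) card by simp
  fix p a assume "p \<in> states A" "a < k"
  then have "p < card (states A)" using assms(2) by auto
  then show "transition A p a = transition B p a \<and> letter_out A p a = letter_out B p a"
    using rows card \<open>a < k\<close> by (auto simp: list_encode_eq)
qed


section \<open>Decidability by partial recursive functions\<close>

text \<open>
  Terms for the partial recursive functions. Arities are not recorded: \<open>evaluates f xs y\<close> means
  that \<open>f\<close> is defined on the argument list \<open>xs\<close>, with value \<open>y\<close>. Primitive recursion and
  minimisation act on the first argument.
\<close>

datatype recf =
    Zero
  | Succ
  | Proj nat
  | Comp recf "recf list"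
  | PrimRec recf recf
  | Minim recf

inductive evaluates :: "recf \<Rightarrow> nat list \<Rightarrow> nat \<Rightarrow> bool" where
  Zero: "evaluates Zero xs 0"
| Succ: "evaluates Succ [x] (Suc x)"
| Proj: "i < length xs \<Longrightarrow> evaluates (Proj i) xs (xs ! i)"
| Comp: "length ys = length gs \<Longrightarrow> (\<forall>i<length gs. evaluates (gs ! i) xs (ys ! i)) \<Longrightarrow>
    evaluates f ys z \<Longrightarrow> evaluates (Comp f gs) xs z"
| PrimRec_0: "evaluates f xs z \<Longrightarrow> evaluates (PrimRec f g) (0 # xs) z"
| PrimRec_Suc: "evaluates (PrimRec f g) (n # xs) y \<Longrightarrow> evaluates g (n # y # xs) z \<Longrightarrow>
    evaluates (PrimRec f g) (Suc n # xs) z"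
| Minim: "evaluates f (n # xs) 0 \<Longrightarrow> (\<forall>i<n. \<exists>y. evaluates f (i # xs) (Suc y)) \<Longrightarrow>
    evaluates (Minim f) xs n"

text \<open>
  The problem of deciding \<open>P\<close> for instances in \<open>D\<close>: nothing is required of the algorithm on codes of
  objects outside \<open>D\<close>.
\<close>

definition decidable_on :: "('a \<Rightarrow> nat) \<Rightarrow> 'a set \<Rightarrow> ('a \<Rightarrow> bool) \<Rightarrow> bool" where
  "decidable_on code D P \<longleftrightarrow>
     (\<exists>f. \<forall>x\<in>D. evaluates f [code x] (if P x then 1 else 0))"

inductive_cases evaluates_ZeroE: "evaluates Zero xs z"
inductive_cases evaluates_SuccE: "evaluates Succ xs z"
inductive_cases evaluates_ProjE: "evaluates (Proj i) xs z"
inductive_cases evaluates_CompE: "evaluates (Comp f gs) xs z"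
inductive_cases evaluates_PrimRec_0E: "evaluates (PrimRec f g) (0 # xs) z"
inductive_cases evaluates_PrimRec_SucE: "evaluates (PrimRec f g) (Suc n # xs) z"
inductive_cases evaluates_MinimE: "evaluates (Minim f) xs z"

lemma evaluates_deterministic:
  "evaluates f xs y \<Longrightarrow> evaluates f xs z \<Longrightarrow> y = z"
proof (induction arbitrary: z rule: evaluates.induct)
  case (Zero xs)
  then show ?case by (rule evaluates_ZeroE) simp
next
  case (Succ x)
  then show ?case by (rule evaluates_SuccE) simp
next
  case (Proj i xs)
  from Proj.prems show ?case by (rule evaluates_ProjE) simp
next
  case (Comp ys gs xs f y)
  from Comp.prems show ?case
  proof (rule evaluates_CompE)
    fix ys' assume ys': "length ys' = length gs"
      "\<forall>i<length gs. evaluates (gs ! i) xs (ys' ! i)" "evaluates f ys' z"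
    have "ys = ys'"
    proof (rule nth_equalityI)
      show "length ys = length ys'" using Comp.hyps ys'(1) by simp
      show "ys ! i = ys' ! i" if "i < length ys" for i
        using Comp.IH(1) ys'(2) Comp.hyps that by simp
    qed
    then show "y = z" using Comp.IH(2) ys'(3) by blast
  qed
next
  case (PrimRec_0 f xs y g)
  from PrimRec_0.prems show ?case by (rule evaluates_PrimRec_0E) (rule PrimRec_0.IH)
next
  case (PrimRec_Suc f g n xs y z w)
  from PrimRec_Suc.prems show ?case
  proof (rule evaluates_PrimRec_SucE)
    fix y' assume "evaluates (PrimRec f g) (n # xs) y'" "evaluates g (n # y' # xs) w"
    then show "z = w" using PrimRec_Suc.IH by blast
  qed
next
  case (Minim f n xs)
  from Minim.prems show ?case
  proof (rule evaluates_MinimE)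
    assume z: "evaluates f (z # xs) 0" "\<forall>i<z. \<exists>y. evaluates f (i # xs) (Suc y)"
    have "\<not> n < z" using Minim.IH(1) z(2) by blast
    moreover have "\<not> z < n"
    proof
      assume "z < n"
      then obtain y where "\<And>v. evaluates f (z # xs) v \<Longrightarrow> Suc y = v" using Minim.IH(2) by blast
      from this[OF z(1)] show False by simp
    qed
    ultimately show "n = z" by simp
  qed
qed

end

theory Submission
  imports Defs "HOL-Number_Theory.Cong"
begin

text \<open>
  Let \<open>d w\<close> be the rotation by which the section of \<open>g\<close> at \<open>w\<close> acts on the first level. If \<open>g\<close> is
  transitive on the \<open>n\<close>-th level, then \<open>g\<close> iterated \<open>k ^ n\<close> times returns to a vertex of that level
  and rotates the children of that vertex by \<open>T n\<close>, the sum of \<open>d w\<close> over the whole level. So \<open>g\<close> is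
  spherically transitive iff every \<open>T n\<close> is coprime to \<open>k\<close>. For an automaton with \<open>m\<close> states the
  sums \<open>T n\<close> mod \<open>k\<close> for all initial states form a vector in \<open>(\<int>/k\<int>)\<^sup>m\<close>, and the vector for \<open>n + 1\<close> is
  a fixed function of the vector for \<open>n\<close>. Hence all vectors occur for some \<open>n < k ^ m\<close>, and finitely
  many coprimality tests suffice.
\<close>

section \<open>Closure properties of computable functions\<close>

text \<open>
  An \<open>n\<close>-ary function is represented by a map on environments \<open>nat \<Rightarrow> nat\<close>, of which only the first
  \<open>n\<close> entries matter. Bound variables then become de Bruijn indices: under a binder the environment
  is shifted to \<open>\<lambda>i. e (Suc i)\<close>, and the bound variable is \<open>e 0\<close>.
\<close>

definition computable :: "nat \<Rightarrow> ((nat \<Rightarrow> nat) \<Rightarrow> nat) \<Rightarrow> bool" where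
  "computable n F \<longleftrightarrow> (\<exists>f. \<forall>e. evaluates f (map e [0..<n]) (F e))"

lemma computable_var: "i < n \<Longrightarrow> computable n (\<lambda>e. e i)"
  unfolding computable_def using evaluates.Proj[of i "map _ [0..<n]"] by (intro exI[of _ "Proj i"]) simp

lemma computable_compose:
  assumes "computable m G" and "\<And>i. i < m \<Longrightarrow> computable n (H i)"
  shows "computable n (\<lambda>e. G (\<lambda>i. H i e))"
proof -
  obtain g where g: "\<And>e. evaluates g (map e [0..<m]) (G e)"
    using assms(1) unfolding computable_def by blast
  obtain h where h: "\<And>i e. i < m \<Longrightarrow> evaluates (h i) (map e [0..<n]) (H i e)"
    using assms(2) unfolding computable_def by metis
  have "evaluates (Comp g (map h [0..<m])) (map e [0..<n]) (G (\<lambda>i. H i e))" for e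
    using h by (intro evaluates.Comp[OF _ _ g]) simp_all
  then show ?thesis unfolding computable_def by blast
qed

lemma computable_compose1:
  assumes "computable (Suc 0) (\<lambda>e. F (e 0))" "computable n A"
  shows "computable n (\<lambda>e. F (A e))"
  using computable_compose[OF assms(1), of n "\<lambda>_. A"] assms(2) by simp

lemma computable_compose2:
  assumes "computable (Suc (Suc 0)) (\<lambda>e. F (e 0) (e (Suc 0)))" "computable n A" "computable n B"
  shows "computable n (\<lambda>e. F (A e) (B e))"
  using computable_compose[OF assms(1), of n "\<lambda>i. if i = 0 then A else B"] assms(2,3) by simp

lemma computable_shift: "computable n A \<Longrightarrow> computable (Suc n) (\<lambda>e. A (\<lambda>i. e (Suc i)))"
  by (erule computable_compose) (rule computable_var, simp)

lemma computable_Suc: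
  assumes "computable n A"
  shows "computable n (\<lambda>e. Suc (A e))"
proof (rule computable_compose1[OF _ assms])
  show "computable (Suc 0) (\<lambda>e. Suc (e 0))"
    unfolding computable_def by (intro exI[of _ Succ]) (simp add: evaluates.Succ)
qed

lemma computable_const: "computable n (\<lambda>_. c)"
proof (induction c)
  case 0
  show ?case unfolding computable_def using evaluates.Zero by blast
qed (rule computable_Suc)

lemma computable_rec:
  assumes "computable n A" "computable n B"
    and "computable (Suc (Suc n)) (\<lambda>e. C (\<lambda>i. e (Suc (Suc i))) (e 0) (e (Suc 0)))"
  shows "computable n (\<lambda>e. rec_nat (A e) (C e) (B e))"
proof -
  obtain f where f: "\<And>e. evaluates f (map e [0..<n]) (A e)"
    using assms(1) unfolding computable_def by blast
  obtain g where g: "\<And>e. evaluates g (map e [0..<Suc (Suc n)])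
      (C (\<lambda>i. e (Suc (Suc i))) (e 0) (e (Suc 0)))"
    using assms(3) unfolding computable_def by blast
  \<comment> \<open>\<open>PrimRec\<close> hands its step function the counter, the previous value
    and then the parameters; \<open>case_nat m (case_nat y e)\<close> lists them in this
    order.\<close>
  have step: "evaluates g (m # y # map e [0..<n]) (C e m y)" for e m y
    using g[of "case_nat m (case_nat y e)"] by (simp add: map_upt_Suc del: upt_Suc)
  have "evaluates (PrimRec f g) (m # map e [0..<n]) (rec_nat (A e) (C e) m)" for e m
    by (induction m) (auto intro: evaluates.PrimRec_0 evaluates.PrimRec_Suc f step)
  then have "computable (Suc n) (\<lambda>e. rec_nat (A (\<lambda>i. e (Suc i))) (C (\<lambda>i. e (Suc i))) (e 0))"
    unfolding computable_def by (intro exI[of _ "PrimRec f g"]) (simp add: map_upt_Suc del: upt_Suc)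
  \<comment> \<open>Substituting \<open>B\<close> for variable 0 and lowering the other indices by
    one replaces the recursion counter by \<open>B e\<close>.\<close>
  from computable_compose[OF this, of n "case_nat B (\<lambda>i e. e i)"] show ?thesis
    using assms(2) by (simp add: computable_var split: nat.split)
qed

section \<open>Arithmetic functions\<close>

lemma computable_add:
  assumes "computable n A" "computable n B"
  shows "computable n (\<lambda>e. A e + B e)"
proof -
  have "computable n (\<lambda>e. rec_nat (A e) (\<lambda>_ y. Suc y) (B e))"
    by (intro computable_rec assms computable_Suc computable_var) simp
  moreover have "rec_nat a (\<lambda>_ y. Suc y) b = a + b" for a b :: nat by (induction b) auto
  ultimately show ?thesis by simp
qed

lemma computable_sum:
  assumes "computable n B" "computable (Suc n) (\<lambda>e. C (\<lambda>i. e (Suc i)) (e 0))"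
  shows "computable n (\<lambda>e. \<Sum>i<B e. C e i)"
proof -
  \<comment> \<open>A recursion step binds index and accumulator, a summand only the index; variable
    1, the accumulator, is skipped.\<close>
  have "computable (Suc (Suc n)) (\<lambda>e. C (\<lambda>i. e (Suc (Suc i))) (e 0))"
    using computable_compose[OF assms(2), of "Suc (Suc n)" "case_nat (\<lambda>e. e 0) (\<lambda>i e. e (Suc (Suc i)))"]
    by (simp add: computable_var split: nat.split)
  then have "computable n (\<lambda>e. rec_nat 0 (\<lambda>i y. y + C e i) (B e))"
    by (intro computable_rec assms computable_add computable_const computable_var) simp_all
  moreover have "rec_nat 0 (\<lambda>i y. y + f i) b = (\<Sum>i<b. f i)" for b :: nat and f :: "nat \<Rightarrow> nat"
    by (induction b) auto
  ultimately show ?thesis by simp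
qed

lemma computable_mult:
  assumes "computable n A" "computable n B"
  shows "computable n (\<lambda>e. A e * B e)"
proof -
  have "computable n (\<lambda>e. \<Sum>i<A e. B e)"
    by (intro computable_sum assms computable_shift)
  then show ?thesis by simp
qed

lemma computable_power:
  assumes "computable n A" "computable n B"
  shows "computable n (\<lambda>e. A e ^ B e)"
proof -
  have "computable n (\<lambda>e. rec_nat 1 (\<lambda>_ y. A e * y) (B e))"
    by (intro computable_rec assms computable_mult computable_const computable_var
        computable_shift[OF computable_shift[OF assms(1)]]) simp
  moreover have "rec_nat 1 (\<lambda>_ y. a * y) b = a ^ b" for a b :: nat by (induction b) auto
  ultimately show ?thesis by simp
qed

lemma computable_diff:
  assumes "computable n A" "computable n B"
  shows "computable n (\<lambda>e. A e - B e)"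
proof -
  \<comment> \<open>Ignoring the previous value and returning the counter gives the predecessor,
    which truncated subtraction then iterates.\<close>
  have "computable (Suc 0) (\<lambda>e. rec_nat 0 (\<lambda>i _. i) (e 0))"
    by (intro computable_rec computable_const computable_var) simp_all
  moreover have "rec_nat 0 (\<lambda>i _. i) b = b - 1" for b :: nat by (cases b) auto
  ultimately have pred: "computable (Suc 0) (\<lambda>e. e 0 - 1)" by simp
  have "computable n (\<lambda>e. rec_nat (A e) (\<lambda>_ y. y - 1) (B e))"
    by (intro computable_rec assms computable_compose1[OF pred] computable_var) simp
  moreover have "rec_nat a (\<lambda>_ y. y - 1) b = a - b" for a b :: nat by (induction b) auto
  ultimately show ?thesis by simp
qed

section \<open>Truth values, bounded quantifiers and division\<close>

lemma computable_eq:
  assumes "computable n A" "computable n B"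
  shows "computable n (\<lambda>e. of_bool (A e = B e))"
proof -
  have "computable n (\<lambda>e. 1 - ((A e - B e) + (B e - A e)))"
    by (intro assms computable_diff computable_add computable_const)
  moreover have "of_bool (a = b) = 1 - ((a - b) + (b - a))" for a b :: nat by auto
  ultimately show ?thesis by simp
qed

lemma computable_not:
  assumes "computable n (\<lambda>e. of_bool (P e))"
  shows "computable n (\<lambda>e. of_bool (\<not> P e))"
proof -
  have "computable n (\<lambda>e. 1 - of_bool (P e))"
    by (intro assms computable_diff computable_const)
  moreover have "of_bool (\<not> b) = 1 - (of_bool b :: nat)" for b by simp
  ultimately show ?thesis by simp
qed

lemma computable_ball:
  assumes "computable n B" "computable (Suc n) (\<lambda>e. of_bool (P (\<lambda>i. e (Suc i)) (e 0)))"
  shows "computable n (\<lambda>e. of_bool (\<forall>i<B e. P e i))"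
proof -
  have "computable n (\<lambda>e. of_bool ((\<Sum>i<B e. of_bool (\<not> P e i)) = (0::nat)))"
    by (intro assms computable_eq computable_sum computable_not computable_const)
  moreover have "(\<Sum>i<b. of_bool (\<not> p i)) = (0::nat) \<longleftrightarrow> (\<forall>i<b. p i)" for b :: nat and p
    by (auto simp: sum_eq_0_iff)
  ultimately show ?thesis by simp
qed

lemma computable_bex:
  assumes "computable n B" "computable (Suc n) (\<lambda>e. of_bool (P (\<lambda>i. e (Suc i)) (e 0)))"
  shows "computable n (\<lambda>e. of_bool (\<exists>i<B e. P e i))"
proof -
  have "computable n (\<lambda>e. of_bool (\<not> (\<forall>i<B e. \<not> P e i)))"
    by (intro assms computable_not computable_ball)
  then show ?thesis by simp
qed

text \<open>A counter advanced \<open>A e\<close> times is reset to 0 whenever it reaches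
  \<open>B e\<close>. For divisor 0 it is never reset, in agreement with
  \<open>a mod 0 = a\<close>.\<close>

lemma computable_mod:
  assumes "computable n A" "computable n B"
  shows "computable n (\<lambda>e. A e mod B e)"
proof -
  have "computable n (\<lambda>e. rec_nat 0 (\<lambda>_ y. of_bool (Suc y \<noteq> B e) * Suc y) (A e))"
    by (intro computable_rec assms computable_mult computable_not computable_eq computable_Suc
        computable_const computable_var computable_shift[OF computable_shift[OF assms(2)]]) simp_all
  moreover have "rec_nat 0 (\<lambda>_ y. of_bool (Suc y \<noteq> b) * Suc y) a = a mod b" for a b :: nat
    by (induction a) (auto simp: mod_Suc)
  ultimately show ?thesis by simp
qed

text \<open>The quotient counts the multiples of \<open>B e\<close> among the numbers from 1 to
  \<open>A e\<close>.\<close>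

lemma computable_div:
  assumes "computable n A" "computable n B"
  shows "computable n (\<lambda>e. A e div B e)"
proof -
  have "computable n (\<lambda>e. \<Sum>i<A e. of_bool (Suc i mod B e = 0))"
    by (intro computable_sum assms computable_mod computable_eq computable_Suc
        computable_const computable_var computable_shift) simp_all
  moreover have "(\<Sum>i<a. of_bool (Suc i mod b = 0)) = a div b" for a b :: nat
    by (induction a) (auto simp: div_Suc)
  ultimately show ?thesis by simp
qed

section \<open>Codes of pairs and lists\<close>

lemma computable_prod_encode:
  assumes "computable n A" "computable n B"
  shows "computable n (\<lambda>e. prod_encode (A e, B e))"
proof -
  have "computable n (\<lambda>e. (\<Sum>i<Suc (A e + B e). i) + A e)"
    by (intro computable_sum computable_add computable_Suc computable_var assms) simp
  moreover have "triangle a = (\<Sum>i<Suc a. i)" for a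
    by (induction a) auto
  ultimately show ?thesis by (simp add: prod_encode_def)
qed

text \<open>Decoding is a bounded search: both components of a pair are at most its code, and by
  injectivity exactly one pair in the square contributes.\<close>

lemma sum_prod_encode_eq:
  "(\<Sum>x<Suc z. \<Sum>y<Suc z. of_bool (prod_encode (x, y) = z) * f x y) = f (fst (prod_decode z)) (snd (prod_decode z))"
  for f :: "nat \<Rightarrow> nat \<Rightarrow> nat"
proof -
  obtain a b where ab: "prod_decode z = (a, b)" by fastforce
  then have z: "z = prod_encode (a, b)" using prod_decode_inverse[of z] by simp
  have "a < Suc z" "b < Suc z"
    unfolding z less_Suc_eq_le by (rule le_prod_encode_1 le_prod_encode_2)+
  have "(\<Sum>x<Suc z. \<Sum>y<Suc z. of_bool (prod_encode (x, y) = z) * f x y) =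
      (\<Sum>x<Suc z. \<Sum>y<Suc z. if x = a then if y = b then f x y else 0 else 0)"
    unfolding z by (intro sum.cong) (auto simp: prod_encode_eq)
  also have "\<dots> = (\<Sum>x<Suc z. if x = a then \<Sum>y<Suc z. if y = b then f x y else 0 else 0)"
    by (intro sum.cong) auto
  also have "\<dots> = f a b" using \<open>a < Suc z\<close> \<open>b < Suc z\<close> by (simp del: sum.lessThan_Suc)
  finally show ?thesis using ab by simp
qed

lemma computable_prod_decode:
  assumes "computable n A"
  shows computable_fst_decode: "computable n (\<lambda>e. fst (prod_decode (A e)))"
    and computable_snd_decode: "computable n (\<lambda>e. snd (prod_decode (A e)))"
proof -
  have "computable n (\<lambda>e. \<Sum>x<Suc (A e). \<Sum>y<Suc (A e). of_bool (prod_encode (x, y) = A e) * x)"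
    by (intro assms computable_sum computable_mult computable_eq computable_prod_encode
        computable_Suc computable_var computable_shift[OF computable_shift[OF assms]]
        computable_shift[OF assms]) simp_all
  then show "computable n (\<lambda>e. fst (prod_decode (A e)))" by (simp only: sum_prod_encode_eq)
  have "computable n (\<lambda>e. \<Sum>x<Suc (A e). \<Sum>y<Suc (A e). of_bool (prod_encode (x, y) = A e) * y)"
    by (intro assms computable_sum computable_mult computable_eq computable_prod_encode
        computable_Suc computable_var computable_shift[OF computable_shift[OF assms]]
        computable_shift[OF assms]) simp_all
  then show "computable n (\<lambda>e. snd (prod_decode (A e)))" by (simp only: sum_prod_encode_eq)
qed

text \<open>A nonempty list is coded as the successor of the pair of its head and the code of its
  tail, so subtracting 1 and taking the second component drops the head.\<close>

definition code_nth :: "nat \<Rightarrow> nat \<Rightarrow> nat" where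
  "code_nth c i = fst (prod_decode (rec_nat c (\<lambda>_ y. snd (prod_decode (y - 1))) i - 1))"

lemma computable_code_nth:
  assumes "computable n A" "computable n B"
  shows "computable n (\<lambda>e. code_nth (A e) (B e))"
  unfolding code_nth_def
  by (intro assms computable_fst_decode computable_snd_decode computable_diff computable_rec
      computable_const computable_var) simp

lemma code_nth_list_encode: "i < length xs \<Longrightarrow> code_nth (list_encode xs) i = xs ! i"
proof -
  assume "i < length xs"
  moreover have "rec_nat (list_encode xs) (\<lambda>_ y. snd (prod_decode (y - 1))) i = list_encode (drop i xs)"
    if "i \<le> length xs" using that
  proof (induction i)
    case (Suc i)
    then show ?case by (simp add: Cons_nth_drop_Suc[symmetric])
  qed simp
  ultimately show ?thesis by (simp add: code_nth_def Cons_nth_drop_Suc[symmetric])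
qed

lemma length_le_list_encode: "length xs \<le> list_encode xs"
proof (induction xs)
  case (Cons x xs)
  then show ?case using le_prod_encode_2[of "list_encode xs" x] by simp
qed simp

section \<open>Periodicity of iterates\<close>

text \<open>Two of the values at the indices \<open>0\<close> to \<open>N\<close> coincide by the
  pigeonhole principle, and from the first of them on the sequence is periodic.\<close>

lemma iterate_in_initial_segment:
  fixes v :: "nat \<Rightarrow> 'a"
  assumes S: "finite S" "card S \<le> N" "\<And>i. v i \<in> S" and step: "\<And>i. v (Suc i) = F (v i)"
  shows "\<exists>i<N. v i = v n"
proof -
  have "\<not> inj_on v {..N}"
  proof
    assume "inj_on v {..N}"
    then have "card {..N} \<le> card S" using S by (intro card_inj_on_le) auto
    then show False using S(2) by simp
  qed
  then obtain i j where ij: "i < j" "j \<le> N" "v i = v j"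
    unfolding inj_on_def by (metis atMost_iff linorder_neqE_nat)
  have shift: "v (i + m) = v (j + m)" for m
    by (induction m) (simp_all add: ij(3) step)
  show ?thesis
  proof (induction n rule: less_induct)
    case (less n)
    show ?case
    proof (cases "n < N")
      case False
      \<comment> \<open>An index from \<open>N\<close> on is at least \<open>j\<close>, so it can be
        lowered by the period \<open>j - i\<close>.\<close>
      then have n: "n = j + (n - j)" "i + (n - j) < n" using ij by auto
      then have "v (i + (n - j)) = v n" using shift[of "n - j"] by simp
      then show ?thesis using less.IH[OF n(2)] by simp
    qed blast
  qed
qed

definition iterates_transitive :: "('a \<Rightarrow> 'a) \<Rightarrow> 'a set \<Rightarrow> bool" where
  "iterates_transitive f S \<longleftrightarrow> (\<forall>x\<in>S. \<forall>y\<in>S. \<exists>i. (f ^^ i) x = y)"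

lemma funpow_in: "f ` S \<subseteq> S \<Longrightarrow> x \<in> S \<Longrightarrow> (f ^^ i) x \<in> S"
  by (induction i) auto

lemma inj_on_funpow: "f ` S \<subseteq> S \<Longrightarrow> inj_on f S \<Longrightarrow> inj_on (f ^^ i) S"
proof (induction i)
  case (Suc i)
  have "(f ^^ i) ` S \<subseteq> S" using funpow_in[OF Suc.prems(1)] by blast
  then have "inj_on (f \<circ> (f ^^ i)) S"
    using Suc by (intro comp_inj_on) (auto intro: inj_on_subset)
  then show ?case by (simp add: comp_def)
qed simp

text \<open>The first \<open>card S\<close> iterates already exhaust the orbit, which is all of
  \<open>S\<close>; by counting they are distinct.\<close>

lemma iterates_transitive_orbit:
  assumes S: "finite S" "f ` S \<subseteq> S" "inj_on f S" "x \<in> S" and tr: "iterates_transitive f S"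
  shows "bij_betw (\<lambda>i. (f ^^ i) x) {..<card S} S" "(f ^^ card S) x = x"
proof -
  have seg: "\<exists>i<card S. (f ^^ i) x = (f ^^ n) x" for n
    by (rule iterate_in_initial_segment[where S = S and F = f]) (use S funpow_in[OF S(2,4)] in auto)
  have im: "(\<lambda>i. (f ^^ i) x) ` {..<card S} = S"
  proof
    show "(\<lambda>i. (f ^^ i) x) ` {..<card S} \<subseteq> S" using funpow_in[OF S(2,4)] by auto
    show "S \<subseteq> (\<lambda>i. (f ^^ i) x) ` {..<card S}"
    proof
      fix y assume "y \<in> S"
      then obtain n where "(f ^^ n) x = y" using tr S(4) unfolding iterates_transitive_def by blast
      then show "y \<in> (\<lambda>i. (f ^^ i) x) ` {..<card S}" using seg[of n] by (metis imageI lessThan_iff)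
    qed
  qed
  then have inj: "inj_on (\<lambda>i. (f ^^ i) x) {..<card S}" by (intro eq_card_imp_inj_on) auto
  show "bij_betw (\<lambda>i. (f ^^ i) x) {..<card S} S" using im inj by (simp add: bij_betw_def)
  \<comment> \<open>The iterate number \<open>card S\<close> repeats an earlier one. If that had a
    positive index \<open>Suc j\<close>, cancelling \<open>f\<close> would identify the iterates
    \<open>j\<close> and \<open>N\<close> and force \<open>i = card S\<close>.\<close>
  obtain i where i: "i < card S" "(f ^^ i) x = (f ^^ card S) x" using seg by blast
  obtain N where N: "card S = Suc N" using i(1) by (cases "card S") auto
  show "(f ^^ card S) x = x"
  proof (cases i)
    case 0
    then show ?thesis using i by simp
  next
    case (Suc j)
    then have "f ((f ^^ j) x) = f ((f ^^ N) x)" using i N by simp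
    then have "(f ^^ j) x = (f ^^ N) x" using inj_onD[OF S(3)] funpow_in[OF S(2,4)] by blast
    then have "j = N" using inj_onD[OF inj, of j N] i N Suc by auto
    then show ?thesis using i N Suc by simp
  qed
qed

section \<open>Transitivity on the levels of the tree\<close>

lemma finite_word_level [simp]: "finite (word_level k n)"
  unfolding word_level_def using finite_lists_length_eq[of "{..<k}" n] by (simp add: lists_eq_set)

text \<open>Splitting off the first letter fits automata, where reading it passes to a successor
  state; the transitivity argument splits off the last letter instead.\<close>

lemma sum_word_level_Suc:
  "(\<Sum>w\<in>word_level k (Suc n). f w) = (\<Sum>a<k. \<Sum>w\<in>word_level k n. f (a # w))"
  unfolding sum.cartesian_product
  by (rule sum.reindex_bij_witness[of _ "\<lambda>(a, w). a # w" "\<lambda>w. (hd w, tl w)"])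
    (auto simp: word_level_def length_Suc_conv)

lemma word_level_Suc_snoc:
  assumes "w \<in> word_level k (Suc n)"
  obtains u a where "w = u @ [a]" "u \<in> word_level k n" "a < k"
proof (cases w rule: rev_cases)
  case (snoc u a)
  then show ?thesis using that assms by (auto simp: word_level_def)
qed (use assms in \<open>simp add: word_level_def\<close>)

lemma tree_aut_word_level: "g \<in> tree_aut k \<Longrightarrow> g ` word_level k n \<subseteq> word_level k n"
  unfolding word_level_def by (auto dest: tree_aut_in_words tree_aut_length simp del: in_lists_conv_set)

lemma tree_aut_inj_word_level: "g \<in> tree_aut k \<Longrightarrow> inj_on g (word_level k n)"
  using tree_aut_inj by (rule inj_on_subset) (auto simp: word_level_def)

section \<open>Forward iterates versus the generated group\<close>

lemma tree_aut_periodic: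
  assumes g: "g \<in> tree_aut k" and u: "u \<in> words k"
  obtains i where "(g ^^ Suc i) u = u"
proof -
  let ?S = "word_level k (length u)"
  have uX: "u \<in> ?S" using u by (simp add: word_level_def)
  have "\<not> inj_on (\<lambda>i. (g ^^ i) u) UNIV"
    using finite_subset[of "range (\<lambda>i. (g ^^ i) u)" ?S] funpow_in[OF tree_aut_word_level[OF g] uX]
      finite_imageD[of "\<lambda>i. (g ^^ i) u" UNIV] by auto
  then obtain i j where ij: "i < j" "(g ^^ i) u = (g ^^ j) u"
    unfolding inj_on_def by (metis linorder_neqE_nat)
  obtain m where m: "j - i = Suc m" using ij(1) by (metis Suc_diff_Suc)
  have "(g ^^ (j - i)) u = u"
  proof -
    \<comment> \<open>Cancelling \<open>g ^^ i\<close>, which is injective on the level, turns a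
      repetition in the orbit into a return to \<open>u\<close> itself.\<close>
    have "(g ^^ i) ((g ^^ (j - i)) u) = (g ^^ i) u"
      using ij by (simp flip: funpow_add comp_apply[of "g ^^ i"])
    moreover have "inj_on (g ^^ i) ?S"
      using inj_on_funpow[OF tree_aut_word_level[OF g] tree_aut_inj_word_level[OF g]] .
    ultimately show ?thesis
      using funpow_in[OF tree_aut_word_level[OF g] uX] uX by (auto dest: inj_onD)
  qed
  then show ?thesis using that[of m] m by simp
qed

lemma AutT_mult_apply:
  assumes "f \<in> tree_aut k" "g \<in> tree_aut k" "w \<in> words k"
  shows "(f \<otimes>\<^bsub>AutT k\<^esub> g) w = f (g w)"
  using assms by (simp add: AutT_def BijGroup_def tree_aut_def compose_eq del: in_lists_conv_set)

lemma AutT_one_apply: "w \<in> words k \<Longrightarrow> \<one>\<^bsub>AutT k\<^esub> w = w"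
  by (simp add: AutT_def BijGroup_def del: in_lists_conv_set)

lemma carrier_AutT [simp]: "carrier (AutT k) = tree_aut k"
  by (simp add: AutT_def)

lemma funpow_in_words: "g \<in> tree_aut k \<Longrightarrow> w \<in> words k \<Longrightarrow> (g ^^ i) w \<in> words k"
  using funpow_in[of g "words k" w i] tree_aut_in_words[of g k] by (simp add: image_subset_iff)

lemma funpow_in_generate:
  assumes g: "g \<in> tree_aut k"
  shows "\<exists>h\<in>generate (AutT k) {g}. \<forall>w\<in>words k. h w = (g ^^ i) w"
proof (induction i)
  case 0
  show ?case by (rule bexI[OF _ generate.one]) (simp add: AutT_one_apply del: in_lists_conv_set)
next
  case (Suc i)
  then obtain h where h: "h \<in> generate (AutT k) {g}" "\<forall>w\<in>words k. h w = (g ^^ i) w" by blast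
  have "h \<in> tree_aut k"
    using group.generate_in_carrier[OF group_AutT, of "{g}" k h] g h(1) by simp
  then show ?case
    using h by (intro bexI[OF _ generate.eng[OF generate.incl[of g] h(1)]])
      (simp_all add: AutT_mult_apply g del: in_lists_conv_set)
qed

text \<open>Inverses need no negative exponents, since every vertex lies on a finite cycle of
  \<open>g\<close>. The exponent may depend on \<open>u\<close>, which suffices because transitivity
  moves one vertex at a time.\<close>

lemma generate_apply:
  assumes g: "g \<in> tree_aut k"
  shows "h \<in> generate (AutT k) {g} \<Longrightarrow> u \<in> words k \<Longrightarrow> \<exists>i. h u = (g ^^ i) u"
proof (induction arbitrary: u rule: generate.induct)
  case one
  then have "\<one>\<^bsub>AutT k\<^esub> u = (g ^^ 0) u" using AutT_one_apply by simp
  then show ?case by blast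
next
  case (incl h)
  then have "h u = (g ^^ 1) u" by simp
  then show ?case by blast
next
  case (inv h)
  interpret group "AutT k" by (rule group_AutT)
  let ?v = "(inv\<^bsub>AutT k\<^esub> g) u"
  have ig: "inv\<^bsub>AutT k\<^esub> g \<in> tree_aut k" using inv_closed[of g] g by simp
  have v: "?v \<in> words k" by (rule tree_aut_in_words[OF ig inv.prems])
  have "g ?v = (g \<otimes>\<^bsub>AutT k\<^esub> inv\<^bsub>AutT k\<^esub> g) u"
    by (rule AutT_mult_apply[OF g ig inv.prems, symmetric])
  also have "\<dots> = u" using r_inv[of g] g AutT_one_apply[OF inv.prems] by simp
  finally have gv: "g ?v = u" .
  obtain i where "(g ^^ Suc i) ?v = ?v" using tree_aut_periodic[OF g v] by blast
  \<comment> \<open>Of the \<open>Suc i\<close> steps from \<open>?v\<close> back to itself the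
    first leads to \<open>u\<close>, so the other \<open>i\<close> lead from \<open>u\<close> to
    \<open>?v\<close>.\<close>
  then have "?v = (g ^^ i) u" by (simp add: funpow_Suc_right gv del: funpow.simps)
  then show ?case using inv.hyps by auto
next
  case (eng h1 h2)
  have h: "h1 \<in> tree_aut k" "h2 \<in> tree_aut k"
    using group.generate_in_carrier[OF group_AutT, of "{g}" k] g eng.hyps by simp_all
  obtain i where i: "h2 u = (g ^^ i) u" using eng.IH(2)[OF eng.prems] by blast
  obtain j where "h1 (h2 u) = (g ^^ j) (h2 u)"
    using eng.IH(1)[OF tree_aut_in_words[OF h(2) eng.prems]] by blast
  then have "(h1 \<otimes>\<^bsub>AutT k\<^esub> h2) u = (g ^^ (j + i)) u"
    using AutT_mult_apply[OF h eng.prems] i by (simp add: funpow_add)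
  then show ?case by blast
qed

lemma spherically_transitive_iff_iterates:
  assumes "g \<in> tree_aut k"
  shows "spherically_transitive k g \<longleftrightarrow> (\<forall>n. iterates_transitive g (word_level k n))"
proof -
  have "(\<exists>h\<in>generate (AutT k) {g}. h u = v) \<longleftrightarrow> (\<exists>i. (g ^^ i) u = v)" if u: "u \<in> words k" for u v
  proof
    assume "\<exists>h\<in>generate (AutT k) {g}. h u = v"
    then obtain h where "h \<in> generate (AutT k) {g}" "h u = v" by blast
    then show "\<exists>i. (g ^^ i) u = v" using generate_apply[OF assms _ u, of h] by metis
  next
    assume "\<exists>i. (g ^^ i) u = v"
    then obtain i where i: "(g ^^ i) u = v" by blast
    obtain h where "h \<in> generate (AutT k) {g}" "\<forall>w\<in>words k. h w = (g ^^ i) w"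
      using funpow_in_generate[OF assms] by blast
    then show "\<exists>h\<in>generate (AutT k) {g}. h u = v" using i u by blast
  qed
  then show ?thesis
    unfolding spherically_transitive_def iterates_transitive_def by (simp add: word_level_def)
qed


text \<open>The section of \<open>g\<close> at \<open>w\<close> acts on the first level as addition of \<open>d w\<close>.\<close>

locale cyclic_cocycle =
  fixes k :: nat and g :: "nat list \<Rightarrow> nat list" and d :: "nat list \<Rightarrow> nat"
  assumes k_pos: "k \<ge> 1" and aut: "g \<in> tree_aut k"
    and snoc: "w \<in> words k \<Longrightarrow> a < k \<Longrightarrow> g (w @ [a]) = g w @ [(a + d w) mod k]"
begin

text \<open>Each application of \<open>g\<close> rotates the last letter by the value of
  \<open>d\<close> at the current vertex, so the rotations add up along the orbit of
  \<open>w\<close>.\<close>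

lemma funpow_snoc:
  assumes "w \<in> words k" "a < k"
  shows "(g ^^ i) (w @ [a]) = (g ^^ i) w @ [(a + (\<Sum>j<i. d ((g ^^ j) w))) mod k]"
proof (induction i)
  case (Suc i)
  then show ?case
    using snoc[OF funpow_in_words[OF aut assms(1)], of _ i] k_pos by (simp add: mod_simps add_ac)
qed (use assms in simp)

text \<open>On the children of a fixed vertex \<open>z\<close> the return map \<open>g ^^ N\<close>
  is rotation by \<open>T\<close>; they form a single orbit of it exactly when \<open>T\<close>
  generates the integers modulo \<open>k\<close>.\<close>

lemma iterates_transitive_word_level_Suc:
  assumes tr: "iterates_transitive g (word_level k n)"
  shows "iterates_transitive g (word_level k (Suc n)) \<longleftrightarrow> coprime (\<Sum>w\<in>word_level k n. d w) k"
proof -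
  define T where "T = (\<Sum>w\<in>word_level k n. d w)"
  define z where "z = replicate n (0::nat)"
  define N where "N = card (word_level k n)"
  have z: "z \<in> word_level k n" "z \<in> words k" unfolding z_def word_level_def using k_pos by auto
  note orb = iterates_transitive_orbit[OF finite_word_level tree_aut_word_level[OF aut]
      tree_aut_inj_word_level[OF aut] z(1) tr, folded N_def]
  have N: "N > 0" using z(1) unfolding N_def by (auto simp: card_gt_0_iff)
  have "(\<Sum>j<N. d ((g ^^ j) z)) = T"
    unfolding T_def by (rule sum.reindex_bij_betw[OF orb(1)])
  then have round: "(g ^^ N) (z @ [a]) = z @ [(a + T) mod k]" if "a < k" for a
    using funpow_snoc[OF z(2) that, of N] orb(2) by simp
  have rounds: "(g ^^ (N * r)) (z @ [a]) = z @ [(a + r * T) mod k]" if "a < k" for a r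
  proof (induction r)
    case (Suc r)
    have "(g ^^ (N * Suc r)) (z @ [a]) = (g ^^ N) ((g ^^ (N * r)) (z @ [a]))"
      by (simp add: funpow_add)
    then show ?case using Suc round[of "(a + r * T) mod k"] k_pos by (simp add: mod_simps add_ac)
  qed (use that in simp)
  show ?thesis unfolding T_def[symmetric]
  proof
    assume "iterates_transitive g (word_level k (Suc n))"
    \<comment> \<open>\<open>1 mod k\<close> is a letter even when \<open>k = 1\<close>.\<close>
    moreover have "z @ [0] \<in> word_level k (Suc n)" "z @ [1 mod k] \<in> word_level k (Suc n)"
      using z k_pos by (auto simp: word_level_def)
    ultimately obtain i where i: "(g ^^ i) (z @ [0]) = z @ [1 mod k]"
      unfolding iterates_transitive_def by blast
    \<comment> \<open>Forgetting the last letter, \<open>g ^^ i\<close> fixes \<open>z\<close>, so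
      \<open>i\<close> is a multiple of \<open>N\<close> and consists of whole rounds.\<close>
    then have "(g ^^ i) z = z" using funpow_snoc[OF z(2), of 0 i] k_pos by simp
    then have "(g ^^ (i mod N)) z = (g ^^ 0) z" using funpow_mod_eq[OF orb(2), of i] by simp
    then have "i mod N = 0" using inj_onD[OF bij_betw_imp_inj_on[OF orb(1)], of "i mod N" 0] N by simp
    then have "i = N * (i div N)" by auto
    then have "z @ [(i div N * T) mod k] = z @ [1 mod k]"
      using rounds[of 0 "i div N"] i k_pos by simp
    then have "[T * (i div N) = Suc 0] (mod k)" by (simp add: cong_def mult.commute)
    then show "coprime T k" using coprime_iff_invertible_nat by blast
  next
    assume "coprime T k"
    then obtain s where s: "[T * s = Suc 0] (mod k)" using cong_solve_coprime_nat by blast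
    \<comment> \<open>As \<open>s\<close> is inverse to \<open>T\<close>,
      \<open>s * (b + k - a)\<close> rounds rotate by \<open>b - a\<close> modulo \<open>k\<close>;
      adding \<open>k\<close> keeps the difference a natural number.\<close>
    have reach: "\<exists>i. (g ^^ i) (z @ [a]) = z @ [b mod k]" if "a < k" for a b
    proof -
      have "[a + (s * (b + k - a)) * T = a + (T * s) * (b + k - a)] (mod k)" by (simp add: ac_simps)
      also have "[a + (T * s) * (b + k - a) = a + Suc 0 * (b + k - a)] (mod k)"
        using s by (intro cong_add cong_mult cong_refl)
      also have "a + Suc 0 * (b + k - a) = b + k" using that by simp
      finally have "(a + (s * (b + k - a)) * T) mod k = b mod k" by (simp add: cong_def)
      then show ?thesis using rounds[OF that] by metis
    qed
    show "iterates_transitive g (word_level k (Suc n))"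
      unfolding iterates_transitive_def
    proof (intro ballI)
      fix x y assume "x \<in> word_level k (Suc n)" "y \<in> word_level k (Suc n)"
      then obtain u a v b where x: "x = u @ [a]" "u \<in> word_level k n" "a < k"
        and y: "y = v @ [b]" "v \<in> word_level k n" "b < k"
        by (elim word_level_Suc_snoc)
      have uw: "u \<in> words k" using x by (simp add: word_level_def)
      \<comment> \<open>Three moves: from \<open>x\<close> to a child of \<open>z\<close>, then
        among the children of \<open>z\<close>, then along the path from \<open>z\<close> to
        \<open>v\<close>.\<close>
      obtain i where "(g ^^ i) u = z" using tr x z unfolding iterates_transitive_def by blast
      then obtain a' where i: "(g ^^ i) x = z @ [a']" "a' < k"
        using funpow_snoc[OF uw x(3), of i] x(1) k_pos by simp
      obtain j where j: "(g ^^ j) z = v" using tr y z unfolding iterates_transitive_def by blast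
      define D where "D = (\<Sum>l<j. d ((g ^^ l) z))"
      \<comment> \<open>The letter \<open>c\<close> compensates the rotation \<open>D\<close> picked
        up between \<open>z\<close> and \<open>v\<close>; \<open>D * (k - 1)\<close> stands for
        \<open>- D\<close> modulo \<open>k\<close>.\<close>
      define c where "c = b + D * (k - 1)"
      have "c + D = b + D * k" unfolding c_def using k_pos by (cases k) simp_all
      then have "(c mod k + D) mod k = b" using y(3) by (metis mod_add_left_eq mod_less mod_mult_self1)
      then have j': "(g ^^ j) (z @ [c mod k]) = y"
        using funpow_snoc[OF z(2), of "c mod k" j] j y(1) k_pos by (simp add: D_def)
      obtain r where "(g ^^ r) (z @ [a']) = z @ [c mod k]" using reach[OF i(2)] by blast
      then have "(g ^^ (j + (r + i))) x = y" using i(1) j' by (simp add: funpow_add)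
      then show "\<exists>i. (g ^^ i) x = y" by blast
    qed
  qed
qed

lemma iterates_transitive_word_level_SucD:
  assumes "iterates_transitive g (word_level k (Suc n))"
  shows "iterates_transitive g (word_level k n)"
  unfolding iterates_transitive_def
proof (intro ballI)
  fix u v assume uv: "u \<in> word_level k n" "v \<in> word_level k n"
  then have "u @ [0] \<in> word_level k (Suc n)" "v @ [0] \<in> word_level k (Suc n)"
    using k_pos by (auto simp: word_level_def)
  then obtain i where "(g ^^ i) (u @ [0]) = v @ [0]"
    using assms unfolding iterates_transitive_def by blast
  then have "(g ^^ i) u = v"
    using funpow_snoc[of u 0 i] uv k_pos by (simp add: word_level_def)
  then show "\<exists>i. (g ^^ i) u = v" by blast
qed

lemma spherically_transitive_iff_coprime:
  "spherically_transitive k g \<longleftrightarrow> (\<forall>n. coprime (\<Sum>w\<in>word_level k n. d w) k)"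
proof -
  have "iterates_transitive g (word_level k n)" if "\<forall>n. coprime (\<Sum>w\<in>word_level k n. d w) k" for n
  proof (induction n)
    case 0
    show ?case by (auto simp: iterates_transitive_def word_level_def intro: exI[of _ 0])
  qed (use that iterates_transitive_word_level_Suc in blast)
  then show ?thesis
    unfolding spherically_transitive_iff_iterates[OF aut]
    using iterates_transitive_word_level_Suc iterates_transitive_word_level_SucD by blast
qed

end

section \<open>Level sums of automata\<close>

lemma run_append: "run A q (u @ v) = run A q u @ run A (foldl (transition A) q u) v"
  by (induction u arbitrary: q) auto

lemma length_run [simp]: "length (run A q w) = length w"
  by (induction w arbitrary: q) auto

lemma tree_section_computed_map:
  "u \<in> words k \<Longrightarrow> tree_section k (computed_map k A q) u = computed_map k A (foldl (transition A) q u)"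
  unfolding tree_section_def computed_map_def by (rule restrict_ext) (simp add: run_append)

text \<open>The section at \<open>w\<close> is computed by the state reached after reading
  \<open>w\<close>. Since it rotates the letters, its output on the letter 0 is the amount of
  rotation.\<close>

lemma cyclic_cocycle_computed_map:
  assumes k: "k \<ge> 1" and g: "computed_map k A q \<in> iterated_wreath k (cyclic_perms k)"
  shows "cyclic_cocycle k (computed_map k A q) (\<lambda>w. letter_out A (foldl (transition A) q w) 0)"
proof
  show "computed_map k A q \<in> tree_aut k" using g by (simp add: iterated_wreath_def)
  fix w a assume w: "w \<in> words k" and a: "a < k"
  let ?p = "foldl (transition A) q w"
  have "root_perm k (computed_map k A ?p) \<in> cyclic_perms k"
    using g w by (simp add: iterated_wreath_def flip: tree_section_computed_map[OF w, of A q]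
        del: in_lists_conv_set)
  then obtain c where c: "c < k" "root_perm k (computed_map k A ?p) = (\<lambda>a\<in>{..<k}. (a + c) mod k)"
    unfolding cyclic_perms_def by blast
  have "letter_out A ?p b = (b + c) mod k" if "b < k" for b
    using fun_cong[OF c(2), of b] that by (simp add: root_perm_def computed_map_def)
  from this[OF a] this[of 0] have "letter_out A ?p a = (a + letter_out A ?p 0) mod k"
    using c(1) by simp
  then show "computed_map k A q (w @ [a]) = computed_map k A q w @ [(a + letter_out A ?p 0) mod k]"
    using w a by (simp add: computed_map_def run_append)
qed (rule k)

definition shift_sum :: "nat \<Rightarrow> 'q automaton \<Rightarrow> 'q \<Rightarrow> nat \<Rightarrow> nat" where
  "shift_sum k A q n = (\<Sum>w\<in>word_level k n. letter_out A (foldl (transition A) q w) 0)"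

lemma shift_sum_0: "shift_sum k A q 0 = letter_out A q 0"
proof -
  have "word_level k 0 = {[]}" by (auto simp: word_level_def)
  then show ?thesis by (simp add: shift_sum_def)
qed

lemma shift_sum_Suc: "shift_sum k A q (Suc n) = (\<Sum>a<k. shift_sum k A (transition A q a) n)"
  unfolding shift_sum_def by (simp add: sum_word_level_Suc)

text \<open>The recursion for one state refers to its successors, so the sums of all states are
  followed at once. Reduced modulo \<open>k\<close> and restricted to \<open>states A\<close>, they
  lie in a set of \<open>k ^ card (states A)\<close> functions.\<close>

lemma shift_sum_mod_initial_segment:
  assumes k: "k \<ge> 1" and A: "initial_automaton k A q"
  shows "\<exists>i<k ^ card (states A). shift_sum k A q i mod k = shift_sum k A q n mod k"
proof -
  let ?v = "\<lambda>n. \<lambda>p\<in>states A. shift_sum k A p n mod k"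
  let ?S = "states A \<rightarrow>\<^sub>E {..<k}"
  have fin: "finite (states A)" using A by (simp add: initial_automaton_def)
  have "\<exists>i<k ^ card (states A). ?v i = ?v n"
  proof (rule iterate_in_initial_segment
      [where S = ?S and F = "\<lambda>v. \<lambda>p\<in>states A. (\<Sum>a<k. v (transition A p a)) mod k"])
    show "finite ?S" using fin by (simp add: finite_PiE)
    show "card ?S \<le> k ^ card (states A)" using fin by (simp add: card_PiE)
    show "?v i \<in> ?S" for i using k by auto
    show "?v (Suc i) = (\<lambda>p\<in>states A. (\<Sum>a<k. ?v i (transition A p a)) mod k)" for i
    proof (rule restrict_ext)
      fix p assume "p \<in> states A"
      then have "(\<Sum>a<k. ?v i (transition A p a)) = (\<Sum>a<k. shift_sum k A (transition A p a) i mod k)"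
        using A by (intro sum.cong) (auto simp: initial_automaton_def)
      then show "shift_sum k A p (Suc i) mod k = (\<Sum>a<k. ?v i (transition A p a)) mod k"
        by (simp add: shift_sum_Suc mod_sum_eq)
    qed
  qed
  then obtain i where i: "i < k ^ card (states A)" "?v i = ?v n" by blast
  have "q \<in> states A" using A by (simp add: initial_automaton_def)
  then have "shift_sum k A q i mod k = shift_sum k A q n mod k" using fun_cong[OF i(2), of q] by simp
  then show ?thesis using i(1) by blast
qed

text \<open>
  Words of length \<open>n\<close> are numbers below \<open>k ^ n\<close>, with the first letter as the least significant digit,
  so that the sum over a level becomes primitive recursive.
\<close>

definition digit_sum :: "nat \<Rightarrow> (nat \<Rightarrow> nat \<Rightarrow> nat) \<Rightarrow> (nat \<Rightarrow> nat) \<Rightarrow> nat \<Rightarrow> nat \<Rightarrow> nat" where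
  "digit_sum k \<delta> out q n = (\<Sum>w<k ^ n. out (rec_nat q (\<lambda>i p. \<delta> p (w div k ^ i mod k)) n))"

lemma digit_sum_0: "digit_sum k \<delta> out q 0 = out q"
  by (simp add: digit_sum_def)

text \<open>The least significant digit is read first and leads to the state
  \<open>\<delta> q a\<close>; the quotient by \<open>k\<close> codes the rest of the word.\<close>

lemma digit_sum_Suc: "digit_sum k \<delta> out q (Suc n) = (\<Sum>a<k. digit_sum k \<delta> out (\<delta> q a) n)"
proof -
  have digits: "rec_nat q (\<lambda>i p. \<delta> p ((a + k * w) div k ^ i mod k)) (Suc m) =
      rec_nat (\<delta> q a) (\<lambda>i p. \<delta> p (w div k ^ i mod k)) m" if "a < k" for a w m
  proof (induction m)
    case (Suc m)
    have "(a + k * w) div k ^ Suc m = w div k ^ m"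
      using that by (simp add: div_mult2_eq)
    then show ?case using Suc by simp
  qed (use that in simp)
  have "digit_sum k \<delta> out q (Suc n) =
      (\<Sum>(a, w)\<in>{..<k} \<times> {..<k ^ n}. out (rec_nat (\<delta> q a) (\<lambda>i p. \<delta> p (w div k ^ i mod k)) n))"
    unfolding digit_sum_def
  proof (rule sum.reindex_bij_witness[of _ "\<lambda>(a, w). a + k * w" "\<lambda>w. (w mod k, w div k)"])
    fix w assume w: "w \<in> {..<k ^ Suc n}"
    then have "k > 0" by (cases k) auto
    then show "(w mod k, w div k) \<in> {..<k} \<times> {..<k ^ n}"
      using w by (auto simp: less_mult_imp_div_less mult.commute)
    show "(case (w mod k, w div k) of (a, w) \<Rightarrow>
        out (rec_nat (\<delta> q a) (\<lambda>i p. \<delta> p (w div k ^ i mod k)) n)) =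
        out (rec_nat q (\<lambda>i p. \<delta> p (w div k ^ i mod k)) (Suc n))"
      using digits[of "w mod k" "w div k" n] \<open>k > 0\<close> by simp
  next
    fix x assume "x \<in> {..<k} \<times> {..<k ^ n}"
    then obtain a w where x: "x = (a, w)" "a < k" "w < k ^ n" by auto
    have "a + k * w < k * Suc w" using x by simp
    also have "\<dots> \<le> k * k ^ n" using x by (intro mult_le_mono) auto
    finally show "(case x of (a, w) \<Rightarrow> a + k * w) \<in> {..<k ^ Suc n}" using x by simp
    show "((case x of (a, w) \<Rightarrow> a + k * w) mod k, (case x of (a, w) \<Rightarrow> a + k * w) div k) = x"
      using x by simp
  qed simp
  then show ?thesis by (simp add: digit_sum_def sum.cartesian_product)
qed

text \<open>Both sides obey the same recursion. Agreement is asked only on states and letters below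
  \<open>k\<close>, all that a code records, and runs on words never leave these.\<close>

lemma digit_sum_eq_shift_sum:
  assumes "initial_automaton k A q"
    and "\<And>p a. p \<in> states A \<Longrightarrow> a < k \<Longrightarrow> \<delta> p a = transition A p a"
    and "\<And>p. p \<in> states A \<Longrightarrow> out p = letter_out A p 0"
  shows "digit_sum k \<delta> out q n = shift_sum k A q n"
  using assms(1)
proof (induction n arbitrary: q)
  case 0
  then show ?case by (simp add: digit_sum_0 shift_sum_0 assms(3) initial_automaton_def)
next
  case (Suc n)
  then show ?case
    by (auto simp: digit_sum_Suc shift_sum_Suc assms(2) initial_automaton_def intro!: sum.cong)
qed

section \<open>The decision procedure on codes of automata\<close>

definition code_entry :: "nat \<Rightarrow> nat \<Rightarrow> nat \<Rightarrow> nat \<times> nat" where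
  "code_entry c p a = prod_decode (code_nth (code_nth (snd (prod_decode c)) p) a)"

lemma code_entry_automaton_code:
  "p < card (states A) \<Longrightarrow> a < k \<Longrightarrow>
    code_entry (automaton_code k (A, q)) p a = (transition A p a, letter_out A p a)"
  by (simp add: code_entry_def automaton_code_def code_nth_list_encode)

lemma card_states_le_automaton_code: "card (states A) \<le> automaton_code k (A, q)"
proof -
  let ?rows = "map (\<lambda>p. list_encode (map (\<lambda>a. prod_encode (transition A p a, letter_out A p a)) [0..<k]))
       [0..<card (states A)]"
  have "card (states A) \<le> list_encode ?rows" using length_le_list_encode[of ?rows] by simp
  also have "\<dots> \<le> automaton_code k (A, q)" by (simp add: automaton_code_def le_prod_encode_2)
  finally show ?thesis .
qed

definition code_shift_sum :: "nat \<Rightarrow> nat \<Rightarrow> nat \<Rightarrow> nat" where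
  "code_shift_sum k c =
    digit_sum k (\<lambda>p a. fst (code_entry c p a)) (\<lambda>p. snd (code_entry c p 0)) (fst (prod_decode c))"

lemma code_shift_sum_automaton_code:
  assumes "k \<ge> 1" "initial_automaton k A q" "states A = {..<card (states A)}"
  shows "code_shift_sum k (automaton_code k (A, q)) n = shift_sum k A q n"
proof -
  have "p < card (states A)" if "p \<in> states A" for p using that assms(3) by auto
  then have "digit_sum k (\<lambda>p a. fst (code_entry (automaton_code k (A, q)) p a))
      (\<lambda>p. snd (code_entry (automaton_code k (A, q)) p 0)) q n = shift_sum k A q n"
    using assms(1,2) by (intro digit_sum_eq_shift_sum) (auto simp: code_entry_automaton_code)
  moreover have "fst (prod_decode (automaton_code k (A, q))) = q" by (simp add: automaton_code_def)
  ultimately show ?thesis by (simp add: code_shift_sum_def)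
qed

lemma computable_code_shift_sum:
  assumes "computable n C" "computable n N"
  shows "computable n (\<lambda>e. code_shift_sum k (C e) (N e))"
proof (rule computable_compose2[OF _ assms])
  show "computable (Suc (Suc 0)) (\<lambda>e. code_shift_sum k (e 0) (e (Suc 0)))"
    unfolding code_shift_sum_def digit_sum_def code_entry_def
    by (intro computable_sum computable_power computable_const computable_var computable_snd_decode
        computable_fst_decode computable_code_nth computable_rec computable_div computable_mod) simp_all
qed

text \<open>
  The code of an automaton with \<open>m\<close> states is at least \<open>m\<close>, hence \<open>k ^ c\<close> bounds the number of vectors
  in \<open>(\<int>/k\<int>)\<^sup>m\<close>.
\<close>

definition accepts_code :: "nat \<Rightarrow> nat \<Rightarrow> bool" where
  "accepts_code k c \<longleftrightarrow> (\<forall>n<k ^ c. \<exists>j<k. code_shift_sum k c n * j mod k = 1 mod k)"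

lemma computable_accepts_code: "computable (Suc 0) (\<lambda>e. of_bool (accepts_code k (e 0)))"
  unfolding accepts_code_def
  by (intro computable_ball computable_bex computable_power computable_const computable_var
      computable_eq computable_mod computable_mult computable_code_shift_sum) simp_all

lemma accepts_code_automaton_code:
  assumes k: "k \<ge> 1" and A: "initial_automaton k A q" "states A = {..<card (states A)}"
  shows "accepts_code k (automaton_code k (A, q)) \<longleftrightarrow> (\<forall>n. coprime (shift_sum k A q n) k)"
proof -
  let ?c = "automaton_code k (A, q)"
  \<comment> \<open>Coprimality is tested by searching for an inverse below \<open>k\<close>;
    writing \<open>1 mod k\<close> makes the test succeed for \<open>k = 1\<close>.\<close>
  have "(\<exists>j<k. x * j mod k = 1 mod k) \<longleftrightarrow> coprime x k" for x
    using coprime_iff_invertible'_nat[of k x] k by (auto simp: cong_def)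
  then have "accepts_code k ?c \<longleftrightarrow> (\<forall>n<k ^ ?c. coprime (shift_sum k A q n) k)"
    using code_shift_sum_automaton_code[OF k A] by (simp add: accepts_code_def)
  also have "\<dots> \<longleftrightarrow> (\<forall>n. coprime (shift_sum k A q n) k)"
  proof (intro iffI allI)
    fix n assume *: "\<forall>n<k ^ ?c. coprime (shift_sum k A q n) k"
    obtain i where i: "i < k ^ card (states A)" "shift_sum k A q i mod k = shift_sum k A q n mod k"
      using shift_sum_mod_initial_segment[OF k A(1)] by blast
    have "k ^ card (states A) \<le> k ^ ?c"
      using k by (intro power_increasing card_states_le_automaton_code) auto
    then have "coprime (shift_sum k A q i) k" using * i(1) by simp
    \<comment> \<open>Coprimality to \<open>k\<close> depends only on the residue, so it passes from
      \<open>i\<close> to \<open>n\<close>.\<close>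
    then have "coprime (shift_sum k A q i mod k) k" using k by simp
    then show "coprime (shift_sum k A q n) k" unfolding i(2) using k by simp
  qed blast
  finally show ?thesis .
qed

theorem theorem2:
  fixes k :: nat
  assumes "k \<ge> 1"
  shows "decidable_on (automaton_code k)
    (automata_computing k (iterated_wreath k (cyclic_perms k)))
    (\<lambda>(A, q). spherically_transitive k (computed_map k A q))"
proof -
  obtain f where f: "\<And>e. evaluates f (map e [0..<Suc 0]) (of_bool (accepts_code k (e 0)))"
    using computable_accepts_code[of k] unfolding computable_def by blast
  have "evaluates f [automaton_code k (A, q)]
      (if spherically_transitive k (computed_map k A q) then 1 else 0)"
    if "(A, q) \<in> automata_computing k (iterated_wreath k (cyclic_perms k))" for A q
  proof -
    have A: "initial_automaton k A q" "states A = {..<card (states A)}"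
      "computed_map k A q \<in> iterated_wreath k (cyclic_perms k)"
      using that by (auto simp: automata_computing_def)
    have "spherically_transitive k (computed_map k A q) \<longleftrightarrow> accepts_code k (automaton_code k (A, q))"
      using cyclic_cocycle.spherically_transitive_iff_coprime
          [OF cyclic_cocycle_computed_map[OF assms A(3)]]
        accepts_code_automaton_code[OF assms A(1,2)]
      by (simp add: shift_sum_def)
    then show ?thesis using f[of "\<lambda>_. automaton_code k (A, q)"] by (simp add: of_bool_def)
  qed
  then show ?thesis unfolding decidable_on_def by (intro exI[of _ f] ballI) (simp only: split_paired_all prod.case)
qed

end
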